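(* Let $0\le r<s$ and let $a,b\in\mathbb{R}$ be such that $P^{s,b}_{r,a}\neq\emptyset$. Then the function $\varphi^{s,b}_{r,a}:\Omega^s_r\to\Lambda^{s,b}_{r,a}$ is onto.
   Context: Fix a constant $c>0$. For $0\le r<s$ and $a,b\in\mathbb{R}$ let $F_{r,a}=\{(t,x)\in\mathbb{R}^2: r\le t,\ a-c(t-r)\le x\le a+c(t-r)\}$, $B_{s,b}=\{(t,x)\in\mathbb{R}^2: t\le s,\ b-c(s-t)\le x\le b+c(s-t)\}$, and $P^{s,b}_{r,a}=F_{r,a}\cap B_{s,b}$ (nonempty if and only if $|b-a|\le c(s-r)$). When $P^{s,b}_{r,a}\ne\emptyset$ let $I^{s,b}_{r,a}=\{x\in\mathbb{R}:(\tfrac12(r+s),x)\in P^{s,b}_{r,a}\}$, a (possibly degenerate) closed interval. Standing assumption: for all such $r,s,a,b$ with $P^{s,b}_{r,a}\neq\emptyset$ we are given a continuous function $\lambda^{s,b}_{r,a}:[0,1]\to I^{s,b}_{r,a}$ mapping $[0,1]$ onto $I^{s,b}_{r,a}$, such that $(a,b,r,s,\xi)\mapsto\lambda^{s,b}_{r,a}(\xi)$ is continuous on $D_\lambda=\{(a,b,r,s,\xi)\in\mathbb{R}^5: 0\le r<s,\ |b-a|\le c(s-r),\ \xi\in[0,1]\}$. Let $t_{nj}=r+\frac{j}{2^n}(s-r)$ for $0\le j\le 2^n$, $n\ge 0$; $V^s_{r,n}=\{t_{nj}:0<j<2^n\}$ for $n\ge1$; $V^s_r=\bigcup_{n\ge1}V^s_{r,n}$;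 $\Omega^s_r=[0,1]^{V^s_r}$. Let $\Lambda^s_r$ be the set of continuous $x:[r,s]\to\mathbb{R}$ with $|x(v)-x(u)|\le c|v-u|$ for all $u,v\in[r,s]$, and $\Lambda^{s,b}_{r,a}=\{x\in\Lambda^s_r: x(r)=a,\ x(s)=b\}$. Definition of $\varphi^{s,b}_{r,a}$ (when $P^{s,b}_{r,a}\neq\emptyset$): for $\omega\in\Omega^s_r$, the function $\varphi(\omega)=\varphi^{s,b}_{r,a}(\omega)$ is defined on $V^s_r\cup\{r,s\}$ recursively by $\varphi(\omega)(r)=a$, $\varphi(\omega)(s)=b$, and, for $m\ge1$ and $1\le j\le 2^{m-1}$, writing $a_{m-1,i}=\varphi(\omega)(t_{m-1,i})$, $$\varphi(\omega)(t_{m,2j-1})=\lambda^{t_{m-1,j},a_{m-1,j}}_{t_{m-1,j-1},a_{m-1,j-1}}(\omega_{t_{m,2j-1}})$$ (at each step the relevant set $P^{t_{m-1,j},a_{m-1,j}}_{t_{m-1,j-1},a_{m-1,j-1}}$ is nonempty, and $t_{m,2j}=t_{m-1,j}$). The resulting function is $c$-Lipschitz on the dense set $V^s_r\cup\{r,s\}$ and $\varphi^{s,b}_{r,a}(\omega)\in\Lambda^{s,b}_{r,a}$ denotes its unique continuous extension to $[r,s]$. *)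

theory Defs
  imports "HOL-Analysis.Analysis"
begin

text \<open>Points of the plane are pairs (time, position). A doubly indexed object such as
  \<open>P\<^sup>s\<^sup>,\<^sup>b\<^sub>r\<^sub>,\<^sub>a\<close> takes its indices in the order \<open>r a s b\<close>.\<close>

definition forward_cone :: "real \<Rightarrow> real \<Rightarrow> real \<Rightarrow> (real \<times> real) set" where
  "forward_cone c r a = {(t, x). r \<le> t \<and> a - c * (t - r) \<le> x \<and> x \<le> a + c * (t - r)}"

definition backward_cone :: "real \<Rightarrow> real \<Rightarrow> real \<Rightarrow> (real \<times> real) set" where
  "backward_cone c s b = {(t, x). t \<le> s \<and> b - c * (s - t) \<le> x \<and> x \<le> b + c * (s - t)}"

definition parallelogram :: "real \<Rightarrow> real \<Rightarrow> real \<Rightarrow> real \<Rightarrow> real \<Rightarrow> (real \<times> real) set" where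
  "parallelogram c r a s b = forward_cone c r a \<inter> backward_cone c s b"

definition mid_section :: "real \<Rightarrow> real \<Rightarrow> real \<Rightarrow> real \<Rightarrow> real \<Rightarrow> real set" where
  "mid_section c r a s b = {x. ((r + s) / 2, x) \<in> parallelogram c r a s b}"

definition D_lambda :: "real \<Rightarrow> (real \<times> real \<times> real \<times> real \<times> real) set" where
  "D_lambda c = {(a, b, r, s, \<xi>). 0 \<le> r \<and> r < s \<and> \<bar>b - a\<bar> \<le> c * (s - r) \<and> \<xi> \<in> {0..1}}"

definition grid :: "real \<Rightarrow> real \<Rightarrow> nat \<Rightarrow> nat \<Rightarrow> real" where
  "grid r s n j = r + real j / 2 ^ n * (s - r)"

definition V_level :: "real \<Rightarrow> real \<Rightarrow> nat \<Rightarrow> real set" where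
  "V_level r s n = {grid r s n j | j. 0 < j \<and> j < 2 ^ n}"

definition V :: "real \<Rightarrow> real \<Rightarrow> real set" where
  "V r s = (\<Union>n\<in>{1..}. V_level r s n)"

definition Omega :: "real \<Rightarrow> real \<Rightarrow> (real \<Rightarrow> real) set" where
  "Omega r s = (V r s \<rightarrow>\<^sub>E {0..1})"

text \<open>Functions with domain \<open>{r..s}\<close> are represented by the elements of
  \<open>extensional {r..s}\<close>, so that equality of such functions is equality on \<open>{r..s}\<close>.\<close>

definition Lip_paths :: "real \<Rightarrow> real \<Rightarrow> real \<Rightarrow> (real \<Rightarrow> real) set" where
  "Lip_paths c r s = {x \<in> extensional {r..s}. continuous_on {r..s} x \<and>
     (\<forall>u\<in>{r..s}. \<forall>v\<in>{r..s}. \<bar>x v - x u\<bar> \<le> c * \<bar>v - u\<bar>)}"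

definition Lip_bridges :: "real \<Rightarrow> real \<Rightarrow> real \<Rightarrow> real \<Rightarrow> real \<Rightarrow> (real \<Rightarrow> real) set" where
  "Lip_bridges c r a s b = {x \<in> Lip_paths c r s. x r = a \<and> x s = b}"

text \<open>\<open>phi_grid lam r a s b \<omega> n j\<close> is the value at the point \<open>grid r s n j\<close>, for \<open>j \<le> 2 ^ n\<close>.
  For odd \<open>j = 2 * i - 1\<close> the neighbours at the previous level have the indices
  \<open>i - 1 = j div 2\<close> and \<open>i = Suc (j div 2)\<close>.\<close>

fun phi_grid :: "(real \<Rightarrow> real \<Rightarrow> real \<Rightarrow> real \<Rightarrow> real \<Rightarrow> real) \<Rightarrow>
    real \<Rightarrow> real \<Rightarrow> real \<Rightarrow> real \<Rightarrow> (real \<Rightarrow> real) \<Rightarrow> nat \<Rightarrow> nat \<Rightarrow> real" where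
  "phi_grid lam r a s b \<omega> 0 j = (if j = 0 then a else b)"
| "phi_grid lam r a s b \<omega> (Suc m) j =
     (if even j then phi_grid lam r a s b \<omega> m (j div 2)
      else lam (grid r s m (j div 2)) (phi_grid lam r a s b \<omega> m (j div 2))
               (grid r s m (Suc (j div 2))) (phi_grid lam r a s b \<omega> m (Suc (j div 2)))
               (\<omega> (grid r s (Suc m) j)))"

definition phi_dense :: "(real \<Rightarrow> real \<Rightarrow> real \<Rightarrow> real \<Rightarrow> real \<Rightarrow> real) \<Rightarrow>
    real \<Rightarrow> real \<Rightarrow> real \<Rightarrow> real \<Rightarrow> (real \<Rightarrow> real) \<Rightarrow> real \<Rightarrow> real" where
  "phi_dense lam r a s b \<omega> u =
     (THE y. \<exists>n j. j \<le> 2 ^ n \<and> u = grid r s n j \<and> y = phi_grid lam r a s b \<omega> n j)"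

definition phi :: "(real \<Rightarrow> real \<Rightarrow> real \<Rightarrow> real \<Rightarrow> real \<Rightarrow> real) \<Rightarrow>
    real \<Rightarrow> real \<Rightarrow> real \<Rightarrow> real \<Rightarrow> (real \<Rightarrow> real) \<Rightarrow> real \<Rightarrow> real" where
  "phi lam r a s b \<omega> =
     (THE x. x \<in> extensional {r..s} \<and> continuous_on {r..s} x \<and>
        (\<forall>u \<in> V r s \<union> {r, s}. x u = phi_dense lam r a s b \<omega> u))"

text \<open>The value at a dyadic point does not depend on its representation, so the definite
  description in \<open>phi_dense\<close> is meaningful and satisfies the intended recursion.\<close>

lemma phi_grid_refine:
  "phi_grid lam r a s b \<omega> (n + k) (2 ^ k * j) = phi_grid lam r a s b \<omega> n j"
  by (induction k) (simp_all add: mult.assoc)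

lemma phi_grid_cong:
  assumes "r < s" "grid r s n j = grid r s m i"
  shows "phi_grid lam r a s b \<omega> n j = phi_grid lam r a s b \<omega> m i"
proof -
  have *: "phi_grid lam r a s b \<omega> n j = phi_grid lam r a s b \<omega> m i"
    if "n \<le> m" "grid r s n j = grid r s m i" for n m i j
  proof -
    obtain k where k: "m = n + k" using \<open>n \<le> m\<close> le_Suc_ex by blast
    have "real j / 2 ^ n = real i / 2 ^ m"
      using that(2) \<open>r < s\<close> unfolding grid_def
      by (metis add_left_cancel diff_gt_0_iff_gt less_irrefl mult_right_cancel)
    then have "real i = real (2 ^ k * j)"
      by (simp add: k power_add field_simps)
    then have "i = 2 ^ k * j" by linarith
    then show ?thesis by (simp add: k phi_grid_refine)
  qed
  show ?thesis
    using *[of n m j i] *[of m n i j] assms(2) by (metis nat_le_linear)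
qed

lemma phi_dense_grid:
  assumes "r < s" "j \<le> 2 ^ n"
  shows "phi_dense lam r a s b \<omega> (grid r s n j) = phi_grid lam r a s b \<omega> n j"
  unfolding phi_dense_def
proof (rule the_equality)
  fix y
  assume "\<exists>n' j'. j' \<le> 2 ^ n' \<and> grid r s n j = grid r s n' j' \<and>
    y = phi_grid lam r a s b \<omega> n' j'"
  then show "y = phi_grid lam r a s b \<omega> n j"
    using phi_grid_cong[OF assms(1)] by metis
qed (use assms in blast)

lemma phi_dense_endpoints:
  assumes "r < s"
  shows "phi_dense lam r a s b \<omega> r = a" "phi_dense lam r a s b \<omega> s = b"
  using phi_dense_grid[OF assms, of 0 0] phi_dense_grid[OF assms, of 1 0]
  by (simp_all add: grid_def)

lemma phi_dense_midpoint:
  assumes "r < s" "1 \<le> m" "1 \<le> j" "j \<le> 2 ^ (m - 1)"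
  shows "phi_dense lam r a s b \<omega> (grid r s m (2 * j - 1)) =
    lam (grid r s (m - 1) (j - 1)) (phi_dense lam r a s b \<omega> (grid r s (m - 1) (j - 1)))
        (grid r s (m - 1) j) (phi_dense lam r a s b \<omega> (grid r s (m - 1) j))
        (\<omega> (grid r s m (2 * j - 1)))"
proof -
  obtain l where m: "m = Suc l" using assms(2) by (cases m) auto
  obtain i where j: "j = Suc i" using assms(3) by (cases j) auto
  have "i < 2 ^ l" using assms(4) by (simp add: m j)
  then show ?thesis
    using assms(1) by (simp add: m j phi_dense_grid)
qed

end

theory Submission
  imports Defs
begin

text \<open>A path with Lipschitz constant \<open>c\<close> from \<open>(r, a)\<close> to \<open>(s, b)\<close> exists exactly when
  \<open>\<bar>b - a\<bar> \<le> c * (s - r)\<close>, and the values which such a path can take at the midpoint of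
  \<open>{r..s}\<close> are exactly those \<open>x\<close> for which each half is again feasible in this sense. That set is
  \<open>mid_section c r a s b\<close>, the range of \<open>lam r a s b\<close>. Both inclusions follow from this
  description, used at every step of the bisection.

  For the inclusion from left to right, each admissible midpoint keeps the increments between
  neighbouring dyadic points of level \<open>n\<close> below \<open>c\<close> times the mesh size
  (\<open>phi_grid_step\<close>). Summing increments gives the Lipschitz bound on all dyadic points
  (\<open>phi_dense_lipschitz\<close>). These points are dense in \<open>{r..s}\<close>, so the function has
  a unique continuous extension, and the extension inherits the Lipschitz constant.

  For surjectivity, let \<open>x\<close> be a Lipschitz path. At a dyadic point \<open>u\<close> that is new at level
  \<open>m + 1\<close>, the value \<open>x u\<close> is an admissible midpoint value between the values of \<open>x\<close> at the two
  neighbours of level \<open>m\<close>. Because \<open>lam\<close> is onto, some parameter in \<open>{0..1}\<close> produces \<open>x u\<close>.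
  Every dyadic point is new at one level only (\<open>odd_grid_inj\<close>), so these parameters can be
  chosen independently and form an element \<open>\<omega>\<close> of \<open>Omega r s\<close>. The recursion driven by
  \<open>\<omega>\<close> reproduces \<open>x\<close> on the dyadic points, hence everywhere by density.\<close>

section \<open>Feasible increments\<close>

lemma parallelogram_nonempty_iff:
  assumes "c > 0" "r < s"
  shows "parallelogram c r a s b \<noteq> {} \<longleftrightarrow> \<bar>b - a\<bar> \<le> c * (s - r)"
proof
  assume "parallelogram c r a s b \<noteq> {}"
  then show "\<bar>b - a\<bar> \<le> c * (s - r)"
    by (auto simp: parallelogram_def forward_cone_def backward_cone_def abs_le_iff algebra_simps)
next
  assume "\<bar>b - a\<bar> \<le> c * (s - r)"
  then have "(r, a) \<in> parallelogram c r a s b"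
    using assms by (auto simp: parallelogram_def forward_cone_def backward_cone_def abs_le_iff)
  then show "parallelogram c r a s b \<noteq> {}"
    by blast
qed

lemma mem_mid_section_iff:
  assumes "r < s"
  shows "x \<in> mid_section c r a s b \<longleftrightarrow>
    \<bar>x - a\<bar> \<le> c * ((s - r) / 2) \<and> \<bar>b - x\<bar> \<le> c * ((s - r) / 2)"
proof -
  have "(r + s) / 2 - r = (s - r) / 2" "s - (r + s) / 2 = (s - r) / 2"
    by (simp_all add: field_simps)
  moreover have "r \<le> (r + s) / 2" "(r + s) / 2 \<le> s"
    using assms by simp_all
  ultimately have "x \<in> mid_section c r a s b \<longleftrightarrow>
      (a - c * ((s - r) / 2) \<le> x \<and> x \<le> a + c * ((s - r) / 2)) \<and>
      (b - c * ((s - r) / 2) \<le> x \<and> x \<le> b + c * ((s - r) / 2))"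
    by (simp only: mid_section_def parallelogram_def forward_cone_def backward_cone_def
        mem_Collect_eq Int_iff case_prod_conv simp_thms)
  then show ?thesis
    by linarith
qed

section \<open>Dyadic points\<close>

lemma grid_zero [simp]: "grid r s n 0 = r"
  by (simp add: grid_def)

lemma grid_top [simp]: "grid r s n (2 ^ n) = s"
  by (simp add: grid_def)

lemma grid_mono:
  assumes "r < s" "i \<le> j"
  shows "grid r s n i \<le> grid r s n j"
  using assms by (auto simp: grid_def intro!: mult_right_mono divide_right_mono)

lemma grid_in_interval:
  assumes "r < s" "j \<le> 2 ^ n"
  shows "grid r s n j \<in> {r..s}"
  using grid_mono[OF assms(1), of 0 j n] grid_mono[OF assms, of n] by simp

lemma grid_Suc_diff: "grid r s n (Suc j) - grid r s n j = (s - r) / 2 ^ n"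
  by (simp add: grid_def field_simps)

lemma grid_refine: "grid r s (n + k) (2 ^ k * j) = grid r s n j"
  by (simp add: grid_def power_add)

lemma grid_midpoint: "(grid r s n j + grid r s n (Suc j)) / 2 = grid r s (Suc n) (Suc (2 * j))"
  by (simp add: grid_def field_simps)

text \<open>A dyadic point determines the level at which it is new: in lowest terms a dyadic fraction
  has an odd numerator.\<close>

lemma odd_grid_inj:
  assumes "r < s" "odd i" "odd j" "grid r s m i = grid r s n j"
  shows "m = n \<and> i = j"
proof -
  have *: "m = n \<and> i = j"
    if "m \<le> n" "odd j" "grid r s m i = grid r s n j" for m n i j
  proof -
    obtain k where k: "n = m + k"
      using \<open>m \<le> n\<close> le_Suc_ex by blast
    have "real i / 2 ^ m = real j / 2 ^ n"
      using that(3) assms(1) by (simp add: grid_def del: times_divide_eq_left)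
    then have "real j = real (2 ^ k * i)"
      by (simp add: k power_add field_simps)
    then have j: "j = 2 ^ k * i"
      by linarith
    with \<open>odd j\<close> have "k = 0"
      by (cases k) auto
    then show ?thesis
      using j k by simp
  qed
  show ?thesis
    using *[of m n j i] *[of n m i j] assms by (metis nat_le_linear)
qed

lemma grid_mem_V:
  assumes "0 < j" "j < 2 ^ n"
  shows "grid r s n j \<in> V r s"
proof -
  have "n \<in> {1..}"
    using assms by (cases n) auto
  moreover have "grid r s n j \<in> V_level r s n"
    using assms by (auto simp: V_level_def)
  ultimately show ?thesis
    unfolding V_def by (rule UN_I)
qed

lemma V_endpoints_eq_grid: "V r s \<union> {r, s} = {grid r s n j | n j. j \<le> 2 ^ n}"
proof (intro equalityI subsetI)
  fix u
  assume "u \<in> V r s \<union> {r, s}"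
  then consider "u = r" | "u = s" | "u \<in> V r s"
    by blast
  then show "u \<in> {grid r s n j | n j. j \<le> 2 ^ n}"
  proof cases
    case 1
    then have "u = grid r s 0 0" "(0::nat) \<le> 2 ^ 0" by simp_all
    then show ?thesis by blast
  next
    case 2
    then have "u = grid r s 0 (2 ^ 0)" by (simp only: grid_top)
    then show ?thesis by blast
  next
    case 3
    then show ?thesis
      unfolding V_def V_level_def using less_imp_le by blast
  qed
next
  fix u
  assume "u \<in> {grid r s n j | n j. j \<le> 2 ^ n}"
  then obtain n j where u: "u = grid r s n j" and j: "j \<le> 2 ^ n"
    by blast
  show "u \<in> V r s \<union> {r, s}"
  proof (cases "j = 0 \<or> j = 2 ^ n")
    case True
    then show ?thesis using u by auto
  next
    case False
    then show ?thesis using j by (simp add: u grid_mem_V)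
  qed
qed

lemma closure_V_endpoints:
  assumes "r < s"
  shows "closure (V r s \<union> {r, s}) = {r..s}"
proof
  have "V r s \<union> {r, s} \<subseteq> {r..s}"
    unfolding V_endpoints_eq_grid using grid_in_interval[OF assms] by blast
  then show "closure (V r s \<union> {r, s}) \<subseteq> {r..s}"
    by (rule closure_minimal) simp
next
  show "{r..s} \<subseteq> closure (V r s \<union> {r, s})"
  proof
    fix u
    assume u: "u \<in> {r..s}"
    show "u \<in> closure (V r s \<union> {r, s})"
      unfolding closure_approachable
    proof (intro allI impI)
      fix e :: real
      assume "e > 0"
      then obtain n where n: "(1 / 2) ^ n < e / (s - r)"
        using assms real_arch_pow_inv[of "e / (s - r)" "1 / 2"] by auto
      then have mesh: "(s - r) / 2 ^ n < e"
        using assms by (simp add: field_simps power_one_over)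
      \<comment> \<open>The last grid point before \<open>u\<close> is closer to \<open>u\<close> than the mesh size.\<close>
      define q where "q = (u - r) / (s - r) * 2 ^ n"
      define j where "j = nat \<lfloor>q\<rfloor>"
      have q: "0 \<le> q" "q \<le> 2 ^ n"
        using u assms by (auto simp: q_def field_simps)
      have j: "real j \<le> q" "q < real j + 1"
        using q by (auto simp: j_def)
      have "real j \<le> 2 ^ n"
        using j q by linarith
      then have "j \<le> 2 ^ n"
        by (metis of_nat_le_iff of_nat_numeral of_nat_power)
      then have mem: "grid r s n j \<in> V r s \<union> {r, s}"
        unfolding V_endpoints_eq_grid by blast
      have "u - grid r s n j = (q - real j) * ((s - r) / 2 ^ n)"
        using assms by (simp add: q_def grid_def field_simps)
      moreover have "0 \<le> (q - real j) * ((s - r) / 2 ^ n)"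
        using j assms by simp
      moreover have "(q - real j) * ((s - r) / 2 ^ n) \<le> 1 * ((s - r) / 2 ^ n)"
        using j assms by (intro mult_right_mono) auto
      ultimately have "dist (grid r s n j) u < e"
        using mesh by (simp add: dist_real_def)
      with mem show "\<exists>y\<in>V r s \<union> {r, s}. dist y u < e"
        by blast
    qed
  qed
qed

text \<open>The definite description in \<open>phi\<close> is met by at most one function, since a continuous
  function is determined by its values on a dense set. Every continuous function with the right
  values at the dyadic points is therefore the path \<open>phi\<close>.\<close>

lemma phi_eqI:
  assumes "r < s" "x \<in> extensional {r..s}" "continuous_on {r..s} x"
    and "\<And>u. u \<in> V r s \<union> {r, s} \<Longrightarrow> x u = phi_dense lam r a s b \<omega> u"
  shows "phi lam r a s b \<omega> = x"
  unfolding phi_def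
proof (rule the_equality)
  show "x \<in> extensional {r..s} \<and> continuous_on {r..s} x \<and>
      (\<forall>u\<in>V r s \<union> {r, s}. x u = phi_dense lam r a s b \<omega> u)"
    using assms by blast
next
  fix y
  assume y: "y \<in> extensional {r..s} \<and> continuous_on {r..s} y \<and>
      (\<forall>u\<in>V r s \<union> {r, s}. y u = phi_dense lam r a s b \<omega> u)"
  show "y = x"
  proof (rule extensionalityI)
    fix u
    assume "u \<in> {r..s}"
    then have "u \<in> closure (V r s \<union> {r, s})"
      by (simp only: closure_V_endpoints[OF assms(1)])
    moreover have "continuous_on (closure (V r s \<union> {r, s})) (\<lambda>u. y u - x u)"
      unfolding closure_V_endpoints[OF assms(1)]
      using y assms(3) by (intro continuous_on_diff) auto
    moreover have "y v - x v = 0" if "v \<in> V r s \<union> {r, s}" for v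
      using y assms(4) that by auto
    ultimately have "y u - x u = 0"
      by (rule continuous_constant_on_closure[rotated 2])
    then show "y u = x u" by simp
  qed (use y assms(2) in auto)
qed

section \<open>Midpoint parametrisations\<close>

text \<open>The range of \<open>lam\<close> is prescribed for all intervals and endpoint values at once, because
  the bisection applies \<open>lam\<close> to every dyadic subinterval with the values constructed so far.\<close>

locale midpoint_parametrisation =
  fixes c :: real and lam :: "real \<Rightarrow> real \<Rightarrow> real \<Rightarrow> real \<Rightarrow> real \<Rightarrow> real"
  assumes c_pos: "c > 0"
    and lam_onto: "\<And>r s a b. 0 \<le> r \<Longrightarrow> r < s \<Longrightarrow> parallelogram c r a s b \<noteq> {} \<Longrightarrow>
      lam r a s b ` {0..1} = mid_section c r a s b"
begin

lemma lam_image_grid: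
  assumes "0 \<le> r" "r < s" "\<bar>q - p\<bar> \<le> c * ((s - r) / 2 ^ n)"
  shows "lam (grid r s n i) p (grid r s n (Suc i)) q ` {0..1} =
    {y. \<bar>y - p\<bar> \<le> c * ((s - r) / 2 ^ Suc n) \<and> \<bar>q - y\<bar> \<le> c * ((s - r) / 2 ^ Suc n)}"
proof -
  have less: "grid r s n i < grid r s n (Suc i)"
    using grid_Suc_diff[of r s n i] assms(2) by (smt (verit) divide_pos_pos zero_less_power)
  have "0 \<le> grid r s n i"
    using grid_mono[OF assms(2), of 0 i n] assms(1) by simp
  moreover have "parallelogram c (grid r s n i) p (grid r s n (Suc i)) q \<noteq> {}"
    using assms(3) by (simp only: parallelogram_nonempty_iff[OF c_pos less] grid_Suc_diff)
  ultimately have "lam (grid r s n i) p (grid r s n (Suc i)) q ` {0..1} =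
      mid_section c (grid r s n i) p (grid r s n (Suc i)) q"
    using lam_onto less by blast
  moreover have "(grid r s n (Suc i) - grid r s n i) / 2 = (s - r) / 2 ^ Suc n"
    unfolding grid_Suc_diff by simp
  ultimately show ?thesis
    by (simp only: set_eq_iff mem_mid_section_iff[OF less] mem_Collect_eq simp_thms)
qed

section \<open>The constructed paths are Lipschitz\<close>

text \<open>Halving the mesh halves the permitted increment, and both halves at a new point obey the
  new bound because \<open>lam\<close> takes its values in the middle section.\<close>

lemma phi_grid_step:
  assumes "0 \<le> r" "r < s" "\<bar>b - a\<bar> \<le> c * (s - r)" "\<omega> \<in> Omega r s" "j < 2 ^ n"
  shows "\<bar>phi_grid lam r a s b \<omega> n (Suc j) - phi_grid lam r a s b \<omega> n j\<bar> \<le> c * ((s - r) / 2 ^ n)"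
  using assms(5)
proof (induction n arbitrary: j)
  case 0
  then show ?case using assms(3) by simp
next
  case (Suc n)
  define i where "i = j div 2"
  define p where "p = phi_grid lam r a s b \<omega> n i"
  define q where "q = phi_grid lam r a s b \<omega> n (Suc i)"
  define y where "y = phi_grid lam r a s b \<omega> (Suc n) (Suc (2 * i))"
  have i: "i < 2 ^ n"
    using Suc.prems by (auto simp: i_def)
  have "grid r s (Suc n) (Suc (2 * i)) \<in> V r s"
    using i by (intro grid_mem_V) simp_all
  then have "\<omega> (grid r s (Suc n) (Suc (2 * i))) \<in> {0..1}"
    using assms(4) unfolding Omega_def by blast
  then have "y \<in> lam (grid r s n i) p (grid r s n (Suc i)) q ` {0..1}"
    by (simp add: y_def p_def q_def)
  then have y: "\<bar>y - p\<bar> \<le> c * ((s - r) / 2 ^ Suc n)" "\<bar>q - y\<bar> \<le> c * ((s - r) / 2 ^ Suc n)"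
    using lam_image_grid[OF assms(1,2) Suc.IH[OF i], of i] unfolding p_def q_def by blast+
  show ?case
  proof (cases "even j")
    case True
    then have j: "j = 2 * i" by (simp add: i_def)
    then have "phi_grid lam r a s b \<omega> (Suc n) j = p"
      "phi_grid lam r a s b \<omega> (Suc n) (Suc j) = y"
      by (simp_all add: p_def y_def)
    then show ?thesis using y by simp
  next
    case False
    then have j: "j = Suc (2 * i)" by (simp add: i_def)
    then have "phi_grid lam r a s b \<omega> (Suc n) j = y"
      "phi_grid lam r a s b \<omega> (Suc n) (Suc j) = q"
      by (simp_all add: q_def y_def)
    then show ?thesis using y by simp
  qed
qed

lemma phi_grid_increment:
  assumes "0 \<le> r" "r < s" "\<bar>b - a\<bar> \<le> c * (s - r)" "\<omega> \<in> Omega r s" "i \<le> j" "j \<le> 2 ^ n"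
  shows "\<bar>phi_grid lam r a s b \<omega> n j - phi_grid lam r a s b \<omega> n i\<bar>
    \<le> c * (grid r s n j - grid r s n i)"
  using assms(5,6)
proof (induction j rule: dec_induct)
  case base
  then show ?case by simp
next
  case (step j)
  have "\<bar>phi_grid lam r a s b \<omega> n (Suc j) - phi_grid lam r a s b \<omega> n j\<bar>
      \<le> c * (grid r s n (Suc j) - grid r s n j)"
    using phi_grid_step[OF assms(1-4), of j n] step.prems by (simp add: grid_Suc_diff)
  then show ?case
    using step.IH step.prems by (simp add: algebra_simps)
qed

lemma phi_dense_lipschitz:
  assumes "0 \<le> r" "r < s" "\<bar>b - a\<bar> \<le> c * (s - r)" "\<omega> \<in> Omega r s"
  shows "c-lipschitz_on (V r s \<union> {r, s}) (phi_dense lam r a s b \<omega>)"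
proof (rule lipschitz_onI)
  let ?f = "phi_dense lam r a s b \<omega>"
  fix u v
  assume "u \<in> V r s \<union> {r, s}" "v \<in> V r s \<union> {r, s}"
  then obtain n i m j where u: "u = grid r s n i" "i \<le> 2 ^ n"
    and v: "v = grid r s m j" "j \<le> 2 ^ m"
    unfolding V_endpoints_eq_grid mem_Collect_eq by (elim exE conjE)
  \<comment> \<open>Increments are summed over one grid, so both points are moved to the common level
    \<open>n + m\<close>.\<close>
  define i' where "i' = 2 ^ m * i"
  define j' where "j' = 2 ^ n * j"
  have u': "u = grid r s (n + m) i'" "i' \<le> 2 ^ (n + m)"
    using u grid_refine[of r s n m i] by (simp_all add: i'_def power_add)
  have v': "v = grid r s (n + m) j'" "j' \<le> 2 ^ (n + m)"
    using v grid_refine[of r s m n j] by (simp_all add: j'_def power_add add.commute)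
  have *: "dist (?f (grid r s N k)) (?f (grid r s N l))
      \<le> c * dist (grid r s N k) (grid r s N l)"
    if "l \<le> k" "k \<le> 2 ^ N" for N k l
    using phi_grid_increment[OF assms that] that grid_mono[OF assms(2) that(1), of N]
    by (simp add: phi_dense_grid[OF assms(2)] dist_real_def)
  show "dist (?f u) (?f v) \<le> c * dist u v"
    using *[of i' j' "n + m"] *[of j' i' "n + m"] u' v'
    by (metis dist_commute nat_le_linear)
qed (use c_pos in simp)

lemma phi_mem_Lip_bridges:
  assumes "0 \<le> r" "r < s" "\<bar>b - a\<bar> \<le> c * (s - r)" "\<omega> \<in> Omega r s"
  shows "phi lam r a s b \<omega> \<in> Lip_bridges c r a s b"
proof -
  obtain g where g: "c-lipschitz_on {r..s} g"
    "\<And>u. u \<in> V r s \<union> {r, s} \<Longrightarrow> g u = phi_dense lam r a s b \<omega> u"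
    using lipschitz_extend_closure[OF phi_dense_lipschitz[OF assms]]
    unfolding closure_V_endpoints[OF assms(2)] by blast
  define x where "x = restrict g {r..s}"
  have lip: "c-lipschitz_on {r..s} x"
    using g(1) by (rule lipschitz_on_transform) (simp add: x_def)
  have cont: "continuous_on {r..s} x"
    using lip by (rule lipschitz_on_continuous_on)
  have ext: "x \<in> extensional {r..s}"
    by (simp add: x_def)
  have dense: "x u = phi_dense lam r a s b \<omega> u" if "u \<in> V r s \<union> {r, s}" for u
    using that g(2)[OF that] closure_subset[of "V r s \<union> {r, s}"]
    unfolding x_def closure_V_endpoints[OF assms(2)] by (metis restrict_apply' subsetD)
  have "\<bar>x v - x u\<bar> \<le> c * \<bar>v - u\<bar>" if "u \<in> {r..s}" "v \<in> {r..s}" for u v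
    using lipschitz_onD[OF lip that(2,1)] by (simp add: dist_real_def)
  then have "x \<in> Lip_bridges c r a s b"
    using ext cont dense[of r] dense[of s] phi_dense_endpoints[OF assms(2)]
    by (simp add: Lip_bridges_def Lip_paths_def)
  moreover have "phi lam r a s b \<omega> = x"
    using assms(2) ext cont dense by (rule phi_eqI)
  ultimately show ?thesis by simp
qed

section \<open>Every Lipschitz path is constructed\<close>

text \<open>A Lipschitz path passes at each new dyadic point through an admissible midpoint value, so
  some parameter produces this value.\<close>

lemma lam_hits_path:
  assumes "0 \<le> r" "r < s" "x \<in> Lip_bridges c r a s b" "i < 2 ^ n"
  shows "\<exists>\<xi>\<in>{0..1}. lam (grid r s n i) (x (grid r s n i)) (grid r s n (Suc i))
    (x (grid r s n (Suc i))) \<xi> = x (grid r s (Suc n) (Suc (2 * i)))"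
proof -
  have lip: "\<bar>x v - x u\<bar> \<le> c * (v - u)" if "u \<in> {r..s}" "v \<in> {r..s}" "u \<le> v" for u v
  proof -
    have "\<bar>x v - x u\<bar> \<le> c * \<bar>v - u\<bar>"
      using assms(3) that(1,2) unfolding Lip_bridges_def Lip_paths_def by blast
    then show ?thesis using that(3) by simp
  qed
  have even_points: "grid r s (Suc n) (2 * i) = grid r s n i"
    "grid r s (Suc n) (Suc (Suc (2 * i))) = grid r s n (Suc i)"
    using grid_refine[of r s n 1 i] grid_refine[of r s n 1 "Suc i"] by simp_all
  have step: "\<bar>x (grid r s m (Suc j)) - x (grid r s m j)\<bar> \<le> c * ((s - r) / 2 ^ m)"
    if "j < 2 ^ m" for m j
    unfolding grid_Suc_diff[of r s m j, symmetric]
    using that assms(2) by (intro lip grid_in_interval grid_mono) simp_all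
  have "x (grid r s (Suc n) (Suc (2 * i))) \<in>
      lam (grid r s n i) (x (grid r s n i)) (grid r s n (Suc i)) (x (grid r s n (Suc i))) ` {0..1}"
    unfolding lam_image_grid[OF assms(1,2) step[OF assms(4)]]
    using step[of "2 * i" "Suc n"] step[of "Suc (2 * i)" "Suc n"] assms(4)
    by (simp add: even_points del: power_Suc) (simp add: less_imp_le)
  then show ?thesis
    by (metis (no_types, lifting) imageE)
qed

lemma Lip_bridge_in_image:
  assumes "0 \<le> r" "r < s" "x \<in> Lip_bridges c r a s b"
  shows "x \<in> phi lam r a s b ` Omega r s"
proof -
  define hits where "hits u \<xi> n i \<longleftrightarrow> lam (grid r s n i) (x (grid r s n i)) (grid r s n (Suc i))
    (x (grid r s n (Suc i))) \<xi> = x u" for u \<xi> n i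
  \<comment> \<open>One parameter has to serve all representations of \<open>u\<close> as a new point. There is at
    most one.\<close>
  have "\<exists>\<xi>\<in>{0..1}. \<forall>n i. i < 2 ^ n \<longrightarrow> u = grid r s (Suc n) (Suc (2 * i)) \<longrightarrow> hits u \<xi> n i" for u
  proof (cases "\<exists>n i. i < 2 ^ n \<and> u = grid r s (Suc n) (Suc (2 * i))")
    case True
    then obtain n i where ni: "i < 2 ^ n" "u = grid r s (Suc n) (Suc (2 * i))"
      by blast
    then obtain \<xi> where \<xi>: "\<xi> \<in> {0..1}" "hits u \<xi> n i"
      using lam_hits_path[OF assms ni(1)] unfolding hits_def by blast
    have "hits u \<xi> n' i'" if "u = grid r s (Suc n') (Suc (2 * i'))" for n' i'
    proof -
      have "Suc n = Suc n' \<and> Suc (2 * i) = Suc (2 * i')"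
        by (rule odd_grid_inj[OF assms(2) _ _ trans[OF ni(2)[symmetric] that]]) simp_all
      then show ?thesis
        using \<xi>(2) by simp
    qed
    then show ?thesis
      using \<xi>(1) by blast
  next
    case False
    then show ?thesis by (intro bexI[of _ 0]) auto
  qed
  then obtain w where w: "\<And>u. w u \<in> {0..1}"
    "\<And>n i. i < 2 ^ n \<Longrightarrow>
      hits (grid r s (Suc n) (Suc (2 * i))) (w (grid r s (Suc n) (Suc (2 * i)))) n i"
    by metis
  define \<omega> where "\<omega> = restrict w (V r s)"
  have Omega: "\<omega> \<in> Omega r s"
    unfolding Omega_def \<omega>_def restrict_PiE_iff using w(1) by blast
  have x: "x \<in> extensional {r..s}" "continuous_on {r..s} x" "x r = a" "x s = b"
    using assms(3) by (auto simp: Lip_bridges_def Lip_paths_def)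
  have grid: "phi_grid lam r a s b \<omega> n j = x (grid r s n j)" if "j \<le> 2 ^ n" for n j
    using that
  proof (induction n arbitrary: j)
    case 0
    then have "j = 0 \<or> j = 1" by auto
    then show ?case
      using x grid_top[of r s 0] by auto
  next
    case (Suc n)
    define i where "i = j div 2"
    show ?case
    proof (cases "even j")
      case True
      then have j: "j = 2 * i" by (simp add: i_def)
      then show ?thesis
        using Suc.IH[of i] Suc.prems grid_refine[of r s n 1 i] by simp
    next
      case False
      then have j: "j = Suc (2 * i)" by (simp add: i_def)
      then have i: "i < 2 ^ n" using Suc.prems by simp
      then have "grid r s (Suc n) (Suc (2 * i)) \<in> V r s"
        by (intro grid_mem_V) simp_all
      then have "\<omega> (grid r s (Suc n) (Suc (2 * i))) = w (grid r s (Suc n) (Suc (2 * i)))"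
        by (simp add: \<omega>_def)
      then show ?thesis
        using w(2)[OF i] Suc.IH[of i] Suc.IH[of "Suc i"] i by (simp add: j hits_def)
    qed
  qed
  have "x u = phi_dense lam r a s b \<omega> u" if "u \<in> V r s \<union> {r, s}" for u
    using that grid phi_dense_grid[OF assms(2)] unfolding V_endpoints_eq_grid by auto
  then have "phi lam r a s b \<omega> = x"
    by (rule phi_eqI[OF assms(2) x(1,2)])
  then show ?thesis
    using Omega by blast
qed

end

section \<open>The image of the path construction\<close>

theorem theorem2p3:
  fixes c r s a b :: real
    and lam :: "real \<Rightarrow> real \<Rightarrow> real \<Rightarrow> real \<Rightarrow> real \<Rightarrow> real"
  assumes "c > 0"
    and "\<And>r s a b. 0 \<le> r \<Longrightarrow> r < s \<Longrightarrow> parallelogram c r a s b \<noteq> {} \<Longrightarrow>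
           continuous_on {0..1} (lam r a s b)"
    and "\<And>r s a b. 0 \<le> r \<Longrightarrow> r < s \<Longrightarrow> parallelogram c r a s b \<noteq> {} \<Longrightarrow>
           lam r a s b ` {0..1} = mid_section c r a s b"
    and "continuous_on (D_lambda c) (\<lambda>(a, b, r, s, \<xi>). lam r a s b \<xi>)"
    and "0 \<le> r" and "r < s"
    and "parallelogram c r a s b \<noteq> {}"
  shows "phi lam r a s b ` Omega r s = Lip_bridges c r a s b"
proof -
  interpret midpoint_parametrisation c lam
    using assms(1,3) by unfold_locales
  have "\<bar>b - a\<bar> \<le> c * (s - r)"
    using assms(7) parallelogram_nonempty_iff[OF assms(1,6)] by blast
  then show ?thesis
    using phi_mem_Lip_bridges[OF assms(5,6)] Lip_bridge_in_image[OF assms(5,6)] by blast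
qed

end
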